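(* Let $G$ be a finite simple graph on $[n]$. Then the following conditions are equivalent: (i) $A(G)=B(G)$; (ii) for every cycle $C$ of $G$ of odd length and for every vertex $i$ of $G$ there exists a vertex $j$ of the cycle $C$ such that $\{i,j\}$ is an edge of $G$.
   Context: Let $K$ be a field, $[n]=\{1,\ldots,n\}$ and $S=K[x_1,\ldots,x_n]$. The graph $G$ is identified with the (at most one-dimensional) simplicial complex on $[n]$ whose facets are the edges $\{i,j\}$ of $G$ and the sets $\{i\}$ with $i$ an isolated vertex of $G$. For $k\ge 0$, a $k$-cover of $G$ is a nonzero vector $c\in\mathbb{Z}_{\ge 0}^n$ with $\sum_{i\in F}c_i\ge k$ for every facet $F$ of this complex; it is squarefree if all $c_i\le 1$. Write $x^c=x_1^{c_1}\cdots x_n^{c_n}$. For $k\ge 1$, $J_k(G)\subseteq S$ is the ideal spanned over $K$ by the monomials $x^c$ with $c$ a $k$-cover, $J_0(G)=S$, and $A(G)=\bigoplus_{k\ge 0}J_k(G)t^k\subseteq S[t]$. $B(G)\subseteq S[t]$ is the $S$-subalgebra generated by all $x^ct^k$ with $k\ge 1$ and $c$ a squarefree $k$-cover of $G$. *)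

theory Defs
  imports
    "HOL-Library.Poly_Mapping"
    "HOL-Computational_Algebra.Polynomial"
    "Graph_Theory.Pair_Digraph"
begin

text \<open>
  A finite simple graph is a \<open>pair_graph\<close>: a finite, loop-free, symmetric relation on its vertices,
  the edge \<open>{i, j}\<close> being the pair of arcs \<open>(i, j)\<close>, \<open>(j, i)\<close>. The library predicate \<open>cycle\<close>
  applies to lists of arcs; it also admits \<open>[(i, j), (j, i)]\<close>, so for a \<open>pair_graph\<close> the cycles of
  length at least 3 (hence all those of odd length) are the usual ones.
\<close>

definition cycle_verts :: "('v \<times> 'v) list \<Rightarrow> 'v set" where
  "cycle_verts p = fst ` set p"

definition facets :: "'v pair_pre_digraph \<Rightarrow> 'v set set" where
  "facets G = {{i, j} | i j. (i, j) \<in> parcs G}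
     \<union> {{i} | i. i \<in> pverts G \<and> (\<forall>j. (i, j) \<notin> parcs G)}"

definition k_cover :: "nat pair_pre_digraph \<Rightarrow> nat \<Rightarrow> (nat \<Rightarrow>\<^sub>0 nat) \<Rightarrow> bool" where
  "k_cover G k c \<longleftrightarrow>
     c \<noteq> 0 \<and> Poly_Mapping.keys c \<subseteq> pverts G \<and> (\<forall>F \<in> facets G. (\<Sum>i\<in>F. Poly_Mapping.lookup c i) \<ge> k)"

definition squarefree_cover :: "(nat \<Rightarrow>\<^sub>0 nat) \<Rightarrow> bool" where
  "squarefree_cover c \<longleftrightarrow> (\<forall>i. Poly_Mapping.lookup c i \<le> 1)"

text \<open>
  Polynomials in the variables \<open>x\<^sub>0, x\<^sub>1, \<dots>\<close> over \<open>'a\<close>, as the monoid algebra of the exponent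
  vectors; \<open>poly_ring V\<close> is the subring of those involving only the variables with index in \<open>V\<close>.
\<close>

type_synonym 'a mpoly = "(nat \<Rightarrow>\<^sub>0 nat) \<Rightarrow>\<^sub>0 'a"

definition poly_ring :: "nat set \<Rightarrow> 'a::field mpoly set" where
  "poly_ring V = {p. \<forall>c \<in> Poly_Mapping.keys p. Poly_Mapping.keys c \<subseteq> V}"

definition x_pow :: "(nat \<Rightarrow>\<^sub>0 nat) \<Rightarrow> 'a::field mpoly" where
  "x_pow c = Poly_Mapping.single c 1"

definition mscale :: "'a::field \<Rightarrow> 'a mpoly \<Rightarrow> 'a mpoly" where
  "mscale a p = Poly_Mapping.single 0 a * p"

lemma vector_space_mscale: "vector_space (mscale :: 'a::field \<Rightarrow> 'a mpoly \<Rightarrow> 'a mpoly)"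
  by unfold_locales
    (simp_all add: mscale_def algebra_simps mult_single single_add flip: mult.assoc)

definition J :: "nat pair_pre_digraph \<Rightarrow> nat \<Rightarrow> 'a::field mpoly set" where
  "J G k = (if k = 0 then poly_ring (pverts G)
            else module.span mscale {x_pow c | c. k_cover G k c})"

text \<open>The outer type \<open>poly\<close> provides the additional variable \<open>t\<close>.\<close>

definition cover_algebra :: "nat pair_pre_digraph \<Rightarrow> 'a::field mpoly poly set" where
  "cover_algebra G = {f. \<forall>k. coeff f k \<in> J G k}"

definition poly_ring_t :: "nat set \<Rightarrow> 'a::field mpoly poly set" where
  "poly_ring_t V = {f. \<forall>k. coeff f k \<in> poly_ring V}"

definition is_subalgebra :: "nat set \<Rightarrow> 'a::field mpoly poly set \<Rightarrow> bool" where
  "is_subalgebra V X \<longleftrightarrow>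
     X \<subseteq> poly_ring_t V \<and> 1 \<in> X
     \<and> (\<forall>f \<in> X. \<forall>g \<in> X. f + g \<in> X \<and> f * g \<in> X)
     \<and> (\<forall>s \<in> poly_ring V. \<forall>f \<in> X. smult s f \<in> X)"

definition squarefree_cover_algebra :: "nat pair_pre_digraph \<Rightarrow> 'a::field mpoly poly set" where
  "squarefree_cover_algebra G = is_subalgebra (pverts G) hull
     {Polynomial.monom (x_pow c) k | c k. k \<ge> 1 \<and> k_cover G k c \<and> squarefree_cover c}"

end

theory Submission
  imports Defs
begin

text \<open>
  Both algebras are spanned by monomials, so they agree iff every \<open>k\<close>-cover \<open>c\<close> with \<open>k \<ge> 1\<close> is a
  sum of squarefree covers of orders \<open>\<ge> 1\<close> with total order \<open>k\<close>, up to a nonnegative remainder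
  (\<open>cover_algebra_eq\<close>, \<open>squarefree_cover_algebra_eq\<close>, \<open>exponent_polys_eq_iff\<close>). What is left is a
  question about covers, in which every squarefree cover has order 1 or 2 and, in the presence of an
  isolated vertex, order 1.

  Suppose that every vertex is adjacent to every odd cycle, and let \<open>c\<close> be a \<open>k\<close>-cover. If \<open>k \<ge> 2\<close>,
  no vertex is isolated and \<open>c\<close> vanishes nowhere, then the all-ones vector is a squarefree 2-cover
  and \<open>c\<close> minus it is a \<open>(k-2)\<close>-cover (\<open>split_off_squarefree_2_cover\<close>). Otherwise, unless \<open>k = 1\<close>,
  there is a vertex \<open>i\<close> that is isolated or has \<open>c\<^sub>i = 0\<close>. An isolated \<open>i\<close> excludes
  odd cycles altogether; if \<open>c\<^sub>i = 0\<close>, every odd cycle has a vertex \<open>j\<close> adjacent to \<open>i\<close>, where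
  \<open>c\<^sub>j \<ge> k\<close>. In all these cases, trivially for \<open>k = 1\<close>, the vertices with \<open>0 < c\<^sub>v < k\<close> span no odd cycle, hence
  a bipartite graph; one of its colour classes together with the vertices where \<open>c\<^sub>v \<ge> k\<close> is a
  squarefree 1-cover that can be subtracted leaving a \<open>(k-1)\<close>-cover
  (\<open>split_off_squarefree_1_cover\<close>). Induction on \<open>k\<close> finishes this direction
  (\<open>cover_exponent_imp_splits\<close>), where for \<open>k = 0\<close> only a remainder is left.

  Conversely, let \<open>i\<close> have no neighbour on the odd cycle \<open>C\<close>. There is a 2-cover that is at most 1 on
  \<open>C\<close> and dominates no squarefree 2-cover, because it is 0 at \<open>i\<close> or \<open>i\<close> is isolated. It is not a sum
  of two 1-covers either, since a 1-cover has total weight more than \<open>|C|/2\<close> on the odd cycle \<open>C\<close>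
  (\<open>obstructing_2_cover\<close>).
\<close>

section \<open>Odd cycles and bipartite subgraphs\<close>

lemma length_rev_path: "length (rev_path p) = length p"
  by (induct p) auto

text \<open>
  A closed walk with a repeated vertex falls into two shorter closed walks, one of which is again of
  odd length.
\<close>

lemma (in wf_digraph) odd_closed_walk_imp_odd_cycle:
  assumes "awalk u p u" "odd (length p)"
  shows "\<exists>C. cycle C \<and> odd (length C)"
  using assms
proof (induct "length p" arbitrary: u p rule: less_induct)
  case less
  then obtain e es where p: "p = e # es" by (cases p) auto
  show ?case
  proof (cases "distinct (tl (awalk_verts u p))")
    case True
    then have "cycle p"
      unfolding cycle_def using less.prems(1) p by (intro exI[of _ u]) simp
    with less.prems(2) show ?thesis by (intro exI[of _ p] conjI)
  next
    case False
    have walk: "awalk (head G e) es u" and e: "e \<in> arcs G" "u = tail G e"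
      using less.prems by (auto simp: p awalk_Cons_iff)
    obtain q r s w where dec: "es = q @ r @ s" "awalk (head G e) q w" "awalk w r w" "awalk w s u"
      and "r \<noteq> []"
      using awalk_not_distinct_decomp[OF walk] False by (auto simp: p)
    show ?thesis
    proof (cases "odd (length r)")
      case True
      have "length r < length p" by (simp add: p dec(1))
      from less.hyps[OF this dec(3) True] show ?thesis .
    next
      case r: False
      have "awalk u (e # q @ s) u"
        using awalk_appendI[OF dec(2,4)] e by (simp add: awalk_Cons_iff)
      moreover have "odd (length (e # q @ s))"
        using less.prems(2) r by (simp add: p dec(1))
      ultimately show ?thesis
        using less.hyps[of "e # q @ s" u] \<open>r \<noteq> []\<close> by (simp add: p dec(1))
    qed
  qed
qed

text \<open>
  Without odd cycles, all walks between two given vertices have the same parity, because one followed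
  by the reverse of another is a closed walk. Vertices are then coloured by the parity of their
  distance from a chosen root of their component.
\<close>

lemma (in pair_pseudo_graph) bipartition_if_no_odd_cycle:
  assumes no_odd: "\<And>C. cycle C \<Longrightarrow> even (length C)"
  shows "\<exists>X. \<forall>(u, v) \<in> parcs G. u \<in> X \<longleftrightarrow> v \<notin> X"
proof -
  have parity: "even (length p) \<longleftrightarrow> even (length q)" if "awalk w p v" "awalk w q v" for w p q v
  proof (rule ccontr)
    assume "\<not> ?thesis"
    then have "odd (length (p @ rev_path q))" by (auto simp: length_rev_path)
    moreover have "awalk w (p @ rev_path q) w"
      using that by (intro awalk_appendI[where v = v]) simp_all
    ultimately show False using odd_closed_walk_imp_odd_cycle no_odd by blast
  qed
  define r where "r v = (SOME w. \<exists>p. awalk w p v)" for v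
  define X where "X = {v. \<exists>p. awalk (r v) p v \<and> even (length p)}"
  have "u \<in> X \<longleftrightarrow> v \<notin> X" if uv: "(u, v) \<in> parcs G" for u v
  proof -
    have step: "awalk w (p @ [(a, b)]) b" if "(a, b) \<in> parcs G" "awalk w p a" for w p a b
      using that arc_implies_awalk[of "(a, b)"] by (intro awalk_appendI[where v = a]) auto
    \<comment> \<open>Adjacent vertices lie in the same component, so their chosen roots coincide.\<close>
    have "(\<lambda>w. \<exists>p. awalk w p u) = (\<lambda>w. \<exists>p. awalk w p v)"
      using step[OF uv] step[OF arcs_symmetric[OF uv]] by blast
    then have r: "r u = r v" by (simp add: r_def)
    have "\<exists>w p. awalk w p u"
      using in_arcsD1[OF uv] by (auto simp: awalk_Nil_iff intro!: exI[of _ u] exI[of _ "[]"])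
    then have "\<exists>p. awalk (r u) p u" unfolding r_def by (rule someI_ex)
    then obtain p where p: "awalk (r u) p u" by blast
    have "u \<in> X \<longleftrightarrow> even (length p)"
      using p parity[OF p] unfolding X_def by blast
    moreover have "v \<in> X \<longleftrightarrow> even (length (p @ [(u, v)]))"
      using step[OF uv p] parity[of "r v"] unfolding X_def r by blast
    ultimately show ?thesis by simp
  qed
  then show ?thesis by blast
qed

lemma bipartition_of_vertex_set:
  assumes "pair_graph G"
    and no_odd: "\<And>C. pre_digraph.cycle (with_proj G) C \<Longrightarrow> cycle_verts C \<subseteq> U \<Longrightarrow> even (length C)"
  shows "\<exists>X. \<forall>(u, v) \<in> parcs G. u \<in> U \<longrightarrow> v \<in> U \<longrightarrow> (u \<in> X \<longleftrightarrow> v \<notin> X)"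
proof -
  interpret G: pair_graph G by fact
  define H where "H = \<lparr>pverts = pverts G \<inter> U, parcs = parcs G \<inter> U \<times> U\<rparr>"
  interpret H: pair_pseudo_graph H
    using G.pair_finite_verts G.pair_finite_arcs G.arcs_symmetric
    by unfold_locales (auto simp: H_def symmetric_def intro!: symI dest: G.in_arcsD1 G.in_arcsD2)
  have "even (length C)" if "H.cycle C" for C
  proof (rule no_odd)
    have "parcs H \<subseteq> parcs G" "pverts H \<subseteq> pverts G" by (auto simp: H_def)
    with that show "G.cycle C"
      unfolding G.cycle_def H.cycle_def G.awalk_def H.awalk_def by blast
    have "set C \<subseteq> parcs H"
      using that unfolding H.cycle_def H.awalk_def by blast
    then show "cycle_verts C \<subseteq> U" by (auto simp: H_def cycle_verts_def)
  qed
  from H.bipartition_if_no_odd_cycle[OF this]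
  obtain X where "\<forall>(u, v) \<in> parcs H. u \<in> X \<longleftrightarrow> v \<notin> X" ..
  then have X: "u \<in> X \<longleftrightarrow> v \<notin> X" if "(u, v) \<in> parcs H" for u v using that by fast
  have "u \<in> X \<longleftrightarrow> v \<notin> X" if "(u, v) \<in> parcs G" "u \<in> U" "v \<in> U" for u v
    using X[of u v] that by (simp add: H_def)
  then show ?thesis by blast
qed

lemma pcas_sum_heads_tails:
  fixes f :: "'v \<Rightarrow> nat"
  assumes "pcas u p v"
  shows "(\<Sum>e\<leftarrow>p. f (fst e)) + f v = (\<Sum>e\<leftarrow>p. f (snd e)) + f u"
  using assms by (induct u p v rule: pcas.induct) auto

text \<open>
  Adding up the cover condition over the arcs counts the values at the tails twice, since heads and
  tails of a closed walk contribute equally; parity makes the resulting inequality strict.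
\<close>

lemma odd_closed_walk_cover_sum:
  fixes f :: "'v \<Rightarrow> nat"
  assumes "pcas u p u" "odd (length p)" "\<And>e. e \<in> set p \<Longrightarrow> 1 \<le> f (fst e) + f (snd e)"
  shows "length p < 2 * (\<Sum>e\<leftarrow>p. f (fst e))"
proof -
  have "(\<Sum>e\<leftarrow>p. 1) \<le> (\<Sum>e\<leftarrow>p. f (fst e) + f (snd e))"
    using assms(3) by (intro sum_list_mono) auto
  also have "\<dots> = 2 * (\<Sum>e\<leftarrow>p. f (fst e))"
    using pcas_sum_heads_tails[OF assms(1), of f] by (simp add: sum_list_addf)
  finally have "length p \<le> 2 * (\<Sum>e\<leftarrow>p. f (fst e))" by (simp add: sum_list_triv)
  moreover have "length p \<noteq> 2 * (\<Sum>e\<leftarrow>p. f (fst e))" using assms(2) by auto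
  ultimately show ?thesis by simp
qed

section \<open>Reduction to exponent vectors\<close>

definition cover_exponent :: "nat pair_pre_digraph \<Rightarrow> (nat \<Rightarrow>\<^sub>0 nat) \<Rightarrow> nat \<Rightarrow> bool" where
  "cover_exponent G c k \<longleftrightarrow> (if k = 0 then Poly_Mapping.keys c \<subseteq> pverts G else k_cover G k c)"

text \<open>
  The exponents \<open>(c, k)\<close> of the monomials in the squarefree cover algebra: \<open>c\<close> is a sum of squarefree
  covers of orders \<open>\<ge> 1\<close> adding up to \<open>k\<close>, plus a remainder, which is the exponent of a coefficient
  in \<open>S\<close>.
\<close>

inductive splits :: "nat pair_pre_digraph \<Rightarrow> (nat \<Rightarrow>\<^sub>0 nat) \<Rightarrow> nat \<Rightarrow> bool" for G where
  remainder: "Poly_Mapping.keys d \<subseteq> pverts G \<Longrightarrow> splits G d 0"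
| add_cover: "\<lbrakk>l \<ge> 1; k_cover G l e; squarefree_cover e; splits G d m\<rbrakk> \<Longrightarrow> splits G (e + d) (l + m)"

text \<open>
  The span of the monomials \<open>x\<^sup>c t\<^sup>k\<close> with \<open>M c k\<close>.
\<close>

definition exponent_polys :: "((nat \<Rightarrow>\<^sub>0 nat) \<Rightarrow> nat \<Rightarrow> bool) \<Rightarrow> 'a::field mpoly poly set" where
  "exponent_polys M = {f. \<forall>k. \<forall>c \<in> Poly_Mapping.keys (coeff f k). M c k}"

lemma exponent_polys_eq_iff:
  "(exponent_polys M :: 'a::field mpoly poly set) = exponent_polys N \<longleftrightarrow> (\<forall>c k. M c k \<longleftrightarrow> N c k)"
proof -
  have mem: "(Polynomial.monom (x_pow c) k :: 'a mpoly poly) \<in> exponent_polys M \<longleftrightarrow> M c k" for M c k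
    by (auto simp: exponent_polys_def x_pow_def)
  show ?thesis
  proof
    assume "(exponent_polys M :: 'a mpoly poly set) = exponent_polys N"
    then show "\<forall>c k. M c k \<longleftrightarrow> N c k" using mem by metis
  qed (simp add: exponent_polys_def)
qed

lemma mpoly_eq_sum_monomials:
  fixes p :: "'b \<Rightarrow>\<^sub>0 'a::comm_monoid_add"
  shows "p = (\<Sum>c \<in> Poly_Mapping.keys p. Poly_Mapping.single c (Poly_Mapping.lookup p c))"
  by (rule poly_mapping_eqI)
    (auto simp: lookup_sum lookup_single when_def in_keys_iff)

lemma span_x_pow:
  "module.span mscale {x_pow c | c. P c} = {p :: 'a::field mpoly. \<forall>c \<in> Poly_Mapping.keys p. P c}"
proof -
  interpret vector_space "mscale :: 'a \<Rightarrow> 'a mpoly \<Rightarrow> 'a mpoly" by (rule vector_space_mscale)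
  have scale: "Poly_Mapping.keys (mscale a p) \<subseteq> Poly_Mapping.keys p" for a and p :: "'a mpoly"
    using keys_mult[of "Poly_Mapping.single 0 a" p] by (auto simp: mscale_def split: if_splits)
  have sub: "subspace {p :: 'a mpoly. \<forall>c \<in> Poly_Mapping.keys p. P c}"
    using scale Poly_Mapping.keys_add by (fastforce simp: subspace_def)
  show ?thesis
  proof (rule equalityI)
    show "span {x_pow c | c. P c} \<subseteq> {p :: 'a mpoly. \<forall>c \<in> Poly_Mapping.keys p. P c}"
      by (rule span_minimal[OF _ sub]) (auto simp: x_pow_def)
    show "{p :: 'a mpoly. \<forall>c \<in> Poly_Mapping.keys p. P c} \<subseteq> span {x_pow c | c. P c}"
    proof
      fix p :: "'a mpoly" assume p: "p \<in> {p. \<forall>c \<in> Poly_Mapping.keys p. P c}"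
      have "(\<Sum>c \<in> Poly_Mapping.keys p. mscale (Poly_Mapping.lookup p c) (x_pow c))
          \<in> span {x_pow c | c. P c}"
        using p by (intro span_sum span_scale span_base) auto
      then show "p \<in> span {x_pow c | c. P c}"
        using mpoly_eq_sum_monomials[of p] by (simp add: mscale_def x_pow_def mult_single)
    qed
  qed
qed

lemma cover_algebra_eq: "cover_algebra G = exponent_polys (cover_exponent G)"
proof -
  have "(p \<in> J G k) = (\<forall>c \<in> Poly_Mapping.keys p. cover_exponent G c k)" for p :: "'a mpoly" and k
    by (auto simp: J_def span_x_pow poly_ring_def cover_exponent_def)
  then show ?thesis by (simp add: cover_algebra_def exponent_polys_def)
qed

lemma keys_add_nat:
  fixes c d :: "'b \<Rightarrow>\<^sub>0 nat"
  shows "Poly_Mapping.keys (c + d) = Poly_Mapping.keys c \<union> Poly_Mapping.keys d"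
  by (auto simp: in_keys_iff lookup_add)

lemma splits_keys: "splits G c k \<Longrightarrow> Poly_Mapping.keys c \<subseteq> pverts G"
  by (induct rule: splits.induct) (auto simp: keys_add_nat k_cover_def)

lemma splits_add: "splits G c k \<Longrightarrow> splits G d l \<Longrightarrow> splits G (c + d) (k + l)"
proof (induct rule: splits.induct)
  case (remainder c)
  from remainder(2) show ?case
  proof (induct rule: splits.induct)
    case (remainder d)
    then show ?case using \<open>Poly_Mapping.keys c \<subseteq> _\<close> splits.remainder[of "c + d" G]
      by (simp add: keys_add_nat)
  next
    case (add_cover l e d m)
    then show ?case using splits.add_cover[of l G e "c + d" m] by (simp add: ac_simps)
  qed
next
  case (add_cover k e c m)
  then show ?case using splits.add_cover[of k G e "c + d" "m + l"] by (simp add: ac_simps)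
qed

text \<open>
  The exponents of a product are sums of exponents of the factors, so closure under multiplication
  comes from \<open>splits_add\<close>; the scalars from \<open>S\<close> have exponents of order 0.
\<close>

lemma is_subalgebra_exponent_polys_splits:
  "is_subalgebra (pverts G) (exponent_polys (splits G) :: 'a::field mpoly poly set)"
  unfolding is_subalgebra_def
proof (intro conjI ballI)
  show "exponent_polys (splits G) \<subseteq> (poly_ring_t (pverts G) :: 'a mpoly poly set)"
    by (auto simp: exponent_polys_def poly_ring_t_def poly_ring_def dest: splits_keys)
  show "(1 :: 'a mpoly poly) \<in> exponent_polys (splits G)"
    by (auto simp: exponent_polys_def coeff_1 intro: splits.remainder)
next
  fix f g :: "'a mpoly poly"
  assume f: "f \<in> exponent_polys (splits G)" and g: "g \<in> exponent_polys (splits G)"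
  show "f + g \<in> exponent_polys (splits G)"
    using f g keys_add by (fastforce simp: exponent_polys_def)
  show "f * g \<in> exponent_polys (splits G)"
    unfolding exponent_polys_def
  proof (intro CollectI allI ballI)
    fix k c assume "c \<in> Poly_Mapping.keys (coeff (f * g) k)"
    then obtain i where i: "i \<le> k" "c \<in> Poly_Mapping.keys (coeff f i * coeff g (k - i))"
      unfolding coeff_mult using keys_sum by fastforce
    then obtain a b where "a \<in> Poly_Mapping.keys (coeff f i)" "b \<in> Poly_Mapping.keys (coeff g (k - i))"
        "c = a + b"
      using keys_mult by blast
    then show "splits G c k"
      using splits_add[of G a i b "k - i"] f g i(1) by (auto simp: exponent_polys_def)
  qed
next
  fix s :: "'a mpoly" and f :: "'a mpoly poly"
  assume s: "s \<in> poly_ring (pverts G)" and f: "f \<in> exponent_polys (splits G)"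
  show "smult s f \<in> exponent_polys (splits G)"
    unfolding exponent_polys_def
  proof (intro CollectI allI ballI)
    fix k c assume "c \<in> Poly_Mapping.keys (coeff (smult s f) k)"
    then obtain a b where "a \<in> Poly_Mapping.keys s" "b \<in> Poly_Mapping.keys (coeff f k)" "c = a + b"
      unfolding coeff_smult using keys_mult by blast
    then show "splits G c k"
      using splits_add[of G a 0 b k] f s by (auto simp: exponent_polys_def poly_ring_def splits.remainder)
  qed
qed

lemma is_subalgebra_sum:
  fixes X :: "'a::field mpoly poly set"
  assumes alg: "is_subalgebra V X" and "\<And>i. i \<in> I \<Longrightarrow> h i \<in> X"
  shows "sum h I \<in> X"
proof -
  have "(0 :: 'a mpoly) \<in> poly_ring V" by (simp add: poly_ring_def)
  then have "smult 0 1 \<in> X" using alg unfolding is_subalgebra_def by blast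
  then have "0 \<in> X" by simp
  with assms show ?thesis
    by (induct I rule: infinite_finite_induct) (auto simp: is_subalgebra_def)
qed

lemma monom_sum: "Polynomial.monom (sum h I) k = (\<Sum>i\<in>I. Polynomial.monom (h i) k)"
  by (induct I rule: infinite_finite_induct) (simp_all flip: add_monom)

text \<open>
  The coefficient \<open>a\<close> is absorbed into the remainder of the splitting, which makes this the term by
  term form of the inclusion of the span in every algebra containing the generators.
\<close>

lemma is_subalgebra_splits_monom:
  assumes alg: "is_subalgebra (pverts G) X"
    and gens: "\<And>e k. k \<ge> 1 \<Longrightarrow> k_cover G k e \<Longrightarrow> squarefree_cover e \<Longrightarrow> Polynomial.monom (x_pow e) k \<in> X"
    and "splits G c k"
  shows "Polynomial.monom (Poly_Mapping.single c (a::'a::field)) k \<in> X"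
  using assms(3)
proof (induct rule: splits.induct)
  case (remainder d)
  have "Poly_Mapping.single d a \<in> poly_ring (pverts G)"
    using remainder by (auto simp: poly_ring_def)
  then have "smult (Poly_Mapping.single d a) 1 \<in> X"
    using alg unfolding is_subalgebra_def by blast
  then show ?case by (simp add: monom_0)
next
  case (add_cover l e d m)
  have "Polynomial.monom (x_pow e) l * Polynomial.monom (Poly_Mapping.single d a) m \<in> X"
    using alg add_cover gens unfolding is_subalgebra_def by blast
  then show ?case by (simp add: mult_monom x_pow_def mult_single)
qed

lemma squarefree_cover_algebra_eq:
  "(squarefree_cover_algebra G :: 'a::field mpoly poly set) = exponent_polys (splits G)"
  unfolding squarefree_cover_algebra_def
proof (rule equalityI[OF hull_minimal], safe)
  fix c k assume "k \<ge> 1" "k_cover G k c" "squarefree_cover c"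
  moreover have "splits G 0 0" by (intro splits.remainder) simp
  ultimately have "splits G c k" using splits.add_cover[of k G c 0 0] by simp
  then show "(Polynomial.monom (x_pow c) k :: 'a mpoly poly) \<in> exponent_polys (splits G)"
    by (auto simp: exponent_polys_def x_pow_def)
next
  show "is_subalgebra (pverts G) (exponent_polys (splits G) :: 'a mpoly poly set)"
    by (rule is_subalgebra_exponent_polys_splits)
next
  let ?gens = "{Polynomial.monom (x_pow c) k | c k. k \<ge> 1 \<and> k_cover G k c \<and> squarefree_cover c}
    :: 'a mpoly poly set"
  fix f :: "'a mpoly poly" assume f: "f \<in> exponent_polys (splits G)"
  show "f \<in> is_subalgebra (pverts G) hull ?gens"
    unfolding hull_def
  proof (intro InterI, safe)
    fix X :: "'a mpoly poly set" assume X: "is_subalgebra (pverts G) X" "?gens \<subseteq> X"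
    have "Polynomial.monom (coeff f k) k \<in> X" for k
    proof -
      have "(\<Sum>c \<in> Poly_Mapping.keys (coeff f k).
          Polynomial.monom (Poly_Mapping.single c (Poly_Mapping.lookup (coeff f k) c)) k) \<in> X"
        using X f by (intro is_subalgebra_sum[OF X(1)] is_subalgebra_splits_monom[OF X(1)])
          (auto simp: exponent_polys_def)
      then show ?thesis
        using mpoly_eq_sum_monomials[of "coeff f k"] by (simp flip: monom_sum)
    qed
    then have "(\<Sum>k\<le>degree f. Polynomial.monom (coeff f k) k) \<in> X"
      by (intro is_subalgebra_sum[OF X(1)])
    then show "f \<in> X" by (simp add: poly_as_sum_of_monoms)
  qed
qed

section \<open>Splitting covers\<close>

lemma k_cover_iff:
  assumes "pair_graph G"
  shows "k_cover G k c \<longleftrightarrow> c \<noteq> 0 \<and> Poly_Mapping.keys c \<subseteq> pverts G \<and>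
    (\<forall>(i, j) \<in> parcs G. k \<le> Poly_Mapping.lookup c i + Poly_Mapping.lookup c j) \<and>
    (\<forall>i \<in> pverts G. (\<forall>j. (i, j) \<notin> parcs G) \<longrightarrow> k \<le> Poly_Mapping.lookup c i)"
proof -
  interpret G: pair_graph G by fact
  have "(\<forall>F \<in> facets G. k \<le> sum (Poly_Mapping.lookup c) F) \<longleftrightarrow>
      (\<forall>i j. (i, j) \<in> parcs G \<longrightarrow> k \<le> sum (Poly_Mapping.lookup c) {i, j}) \<and>
      (\<forall>i \<in> pverts G. (\<forall>j. (i, j) \<notin> parcs G) \<longrightarrow> k \<le> sum (Poly_Mapping.lookup c) {i})"
    unfolding facets_def by blast
  moreover have "sum (Poly_Mapping.lookup c) {i, j} = Poly_Mapping.lookup c i + Poly_Mapping.lookup c j"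
    if "(i, j) \<in> parcs G" for i j
    using G.no_loops'[OF that] by simp
  ultimately show ?thesis unfolding k_cover_def by auto
qed

text \<open>
  For positive order the zero vector violates the condition on any facet, so that \<open>c \<noteq> 0\<close> comes for
  free once there is a vertex.
\<close>

lemma k_cover_posI:
  assumes G: "pair_graph G" and "pverts G \<noteq> {}" "1 \<le> k" "Poly_Mapping.keys c \<subseteq> pverts G"
    and edge: "\<And>i j. (i, j) \<in> parcs G \<Longrightarrow> k \<le> Poly_Mapping.lookup c i + Poly_Mapping.lookup c j"
    and isolated: "\<And>i. i \<in> pverts G \<Longrightarrow> (\<And>j. (i, j) \<notin> parcs G) \<Longrightarrow> k \<le> Poly_Mapping.lookup c i"
  shows "k_cover G k c"
proof -
  obtain i where "i \<in> pverts G" using assms(2) by blast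
  then have "c \<noteq> 0" using edge[of i] isolated[of i] \<open>1 \<le> k\<close> by fastforce
  then show ?thesis using assms by (auto simp: k_cover_iff[OF G])
qed

definition vec :: "nat set \<Rightarrow> (nat \<Rightarrow> nat) \<Rightarrow> (nat \<Rightarrow>\<^sub>0 nat)" where
  "vec V f = (\<Sum>i\<in>V. Poly_Mapping.single i (f i))"

lemma lookup_vec:
  "finite V \<Longrightarrow> Poly_Mapping.lookup (vec V f) i = (if i \<in> V then f i else 0)"
  by (simp add: vec_def lookup_sum lookup_single when_def)

lemma splits_imp_cover_exponent:
  assumes G: "pair_graph G" and "splits G c k"
  shows "cover_exponent G c k"
  using assms(2)
proof (induct rule: splits.induct)
  case (add_cover l e d m)
  have e: "i \<in> pverts G \<Longrightarrow> (\<forall>j. (i, j) \<notin> parcs G) \<Longrightarrow> l \<le> Poly_Mapping.lookup e i"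
    "(i, j) \<in> parcs G \<Longrightarrow> l \<le> Poly_Mapping.lookup e i + Poly_Mapping.lookup e j" for i j
    using \<open>k_cover G l e\<close> by (auto simp: k_cover_iff[OF G])
  have d: "i \<in> pverts G \<Longrightarrow> (\<forall>j. (i, j) \<notin> parcs G) \<Longrightarrow> m \<le> Poly_Mapping.lookup d i"
    "(i, j) \<in> parcs G \<Longrightarrow> m \<le> Poly_Mapping.lookup d i + Poly_Mapping.lookup d j" for i j
    using \<open>cover_exponent G d m\<close> by (auto simp: k_cover_iff[OF G] cover_exponent_def split: if_splits)
  have "e \<noteq> 0" "Poly_Mapping.keys e \<subseteq> pverts G" "Poly_Mapping.keys d \<subseteq> pverts G"
    using add_cover by (auto simp: k_cover_def dest: splits_keys)
  moreover from this have "pverts G \<noteq> {}" by auto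
  ultimately have "k_cover G (l + m) (e + d)"
    using \<open>1 \<le> l\<close> e d
    by (intro k_cover_posI[OF G]) (fastforce simp: lookup_add keys_add_nat)+
  then show ?case using \<open>1 \<le> l\<close> by (simp add: cover_exponent_def)
qed (simp add: cover_exponent_def)

text \<open>
  For \<open>k > l\<close> this says when \<open>c - e\<close> is a \<open>(k-l)\<close>-cover; for \<open>k \<le> l\<close> the difference is a remainder,
  possibly zero, and \<open>cover_exponent\<close> asks only for its support.
\<close>

lemma cover_exponent_diff:
  assumes G: "pair_graph G" and keys: "Poly_Mapping.keys c \<subseteq> pverts G" and "pverts G \<noteq> {}"
    and edge: "\<And>i j. (i, j) \<in> parcs G \<Longrightarrow>
      k - l + Poly_Mapping.lookup e i + Poly_Mapping.lookup e j \<le> Poly_Mapping.lookup c i + Poly_Mapping.lookup c j"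
    and isolated: "\<And>i. i \<in> pverts G \<Longrightarrow> (\<And>j. (i, j) \<notin> parcs G) \<Longrightarrow>
      k - l + Poly_Mapping.lookup e i \<le> Poly_Mapping.lookup c i"
    and le: "\<And>i. Poly_Mapping.lookup e i \<le> Poly_Mapping.lookup c i"
  shows "cover_exponent G (c - e) (k - l)"
proof -
  have sub: "Poly_Mapping.keys (c - e) \<subseteq> pverts G"
    using keys by (auto simp: in_keys_iff lookup_minus)
  show ?thesis
  proof (cases "k - l = 0")
    case False
    have "k_cover G (k - l) (c - e)"
    proof (rule k_cover_posI[OF G \<open>pverts G \<noteq> {}\<close> _ sub])
      show "k - l \<le> Poly_Mapping.lookup (c - e) i + Poly_Mapping.lookup (c - e) j"
        if "(i, j) \<in> parcs G" for i j
        using edge[OF that] le[of i] le[of j] by (simp add: lookup_minus)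
    next
      fix i assume "i \<in> pverts G" "\<And>j. (i, j) \<notin> parcs G"
      then show "k - l \<le> Poly_Mapping.lookup (c - e) i"
        using isolated[of i] le[of i] by (simp add: lookup_minus)
    qed (use False in simp)
    with False show ?thesis by (simp add: cover_exponent_def)
  qed (simp add: cover_exponent_def sub)
qed

text \<open>
  The all-ones vector lowers every edge sum by exactly 2.
\<close>

lemma split_off_squarefree_2_cover:
  assumes G: "pair_graph G" and cov: "k_cover G k c"
    and no_isolated: "\<And>i. i \<in> pverts G \<Longrightarrow> \<exists>j. (i, j) \<in> parcs G"
    and pos: "\<And>i. i \<in> pverts G \<Longrightarrow> 1 \<le> Poly_Mapping.lookup c i"
  shows "\<exists>e. k_cover G 2 e \<and> squarefree_cover e \<and> (\<forall>i. Poly_Mapping.lookup e i \<le> Poly_Mapping.lookup c i)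
    \<and> cover_exponent G (c - e) (k - 2)"
proof -
  interpret G: pair_graph G by fact
  have c: "Poly_Mapping.keys c \<subseteq> pverts G"
    "\<And>i j. (i, j) \<in> parcs G \<Longrightarrow> k \<le> Poly_Mapping.lookup c i + Poly_Mapping.lookup c j"
    using cov by (auto simp: k_cover_iff[OF G])
  have ne: "pverts G \<noteq> {}" using cov by (auto simp: k_cover_def)
  define e where "e = vec (pverts G) (\<lambda>_. 1)"
  have e: "Poly_Mapping.lookup e i = (if i \<in> pverts G then 1 else 0)" for i
    by (simp add: e_def lookup_vec G.pair_finite_verts)
  have le: "Poly_Mapping.lookup e i \<le> Poly_Mapping.lookup c i" for i
    using pos[of i] by (simp add: e)
  have "k_cover G 2 e"
    using ne no_isolated by (intro k_cover_posI[OF G]) (auto simp: e in_keys_iff dest: G.in_arcsD1 G.in_arcsD2)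
  moreover have "squarefree_cover e" by (simp add: squarefree_cover_def e)
  moreover have "cover_exponent G (c - e) (k - 2)"
  proof (rule cover_exponent_diff[OF G c(1) ne _ _ le])
    show "k - 2 + Poly_Mapping.lookup e i + Poly_Mapping.lookup e j
        \<le> Poly_Mapping.lookup c i + Poly_Mapping.lookup c j" if "(i, j) \<in> parcs G" for i j
      using c(2)[OF that] pos[of i] pos[of j] that by (auto simp: e dest: G.in_arcsD1 G.in_arcsD2)
  qed (use no_isolated in blast)
  ultimately show ?thesis using le by blast
qed

text \<open>
  Subtracting the indicator of a vertex cover is harmless at an edge with exactly one endpoint in it,
  and at an edge with both endpoints in it if \<open>c\<close> sums to more than \<open>k\<close> there. All vertices
  with \<open>c\<^sub>v \<ge> k\<close> are taken. The remaining vertices with \<open>c\<^sub>v > 0\<close> form the set \<open>U\<close>; every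
  edge lies inside \<open>U\<close> or has an endpoint with value at least \<open>k\<close>. The hypothesis on odd cycles makes
  \<open>U\<close> bipartite, and a colour class has exactly one endpoint of each edge inside \<open>U\<close>.
\<close>

lemma split_off_squarefree_1_cover:
  assumes G: "pair_graph G" and cov: "k_cover G k c" and k: "1 \<le> k"
    and no_odd: "\<And>C. pre_digraph.cycle (with_proj G) C \<Longrightarrow> odd (length C) \<Longrightarrow>
      \<exists>j \<in> cycle_verts C. k \<le> Poly_Mapping.lookup c j \<or> Poly_Mapping.lookup c j = 0"
  shows "\<exists>e. k_cover G 1 e \<and> squarefree_cover e \<and> (\<forall>i. Poly_Mapping.lookup e i \<le> Poly_Mapping.lookup c i)
    \<and> cover_exponent G (c - e) (k - 1)"
proof -
  interpret G: pair_graph G by fact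
  let ?c = "Poly_Mapping.lookup c"
  have c: "Poly_Mapping.keys c \<subseteq> pverts G"
    "\<And>i j. (i, j) \<in> parcs G \<Longrightarrow> k \<le> ?c i + ?c j"
    "\<And>i. i \<in> pverts G \<Longrightarrow> (\<And>j. (i, j) \<notin> parcs G) \<Longrightarrow> k \<le> ?c i"
    using cov by (auto simp: k_cover_iff[OF G])
  have ne: "pverts G \<noteq> {}" using cov by (auto simp: k_cover_def)
  define U where "U = {v. 0 < ?c v \<and> ?c v < k}"
  have "even (length C)" if "G.cycle C" "cycle_verts C \<subseteq> U" for C
    using no_odd[OF that(1)] that(2) by (fastforce simp: U_def)
  from bipartition_of_vertex_set[OF G this]
  obtain X where "\<forall>(i, j) \<in> parcs G. i \<in> U \<longrightarrow> j \<in> U \<longrightarrow> (i \<in> X \<longleftrightarrow> j \<notin> X)" ..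
  then have X: "i \<in> X \<longleftrightarrow> j \<notin> X" if "(i, j) \<in> parcs G" "i \<in> U" "j \<in> U" for i j
    using that by fast
  define e where "e = vec (pverts G) (\<lambda>v. if k \<le> ?c v \<or> v \<in> U \<inter> X then 1 else 0)"
  have e: "Poly_Mapping.lookup e i = (if i \<in> pverts G \<and> (k \<le> ?c i \<or> i \<in> U \<inter> X) then 1 else 0)" for i
    by (simp add: e_def lookup_vec G.pair_finite_verts)
  have le: "Poly_Mapping.lookup e i \<le> ?c i" for i
    using k by (auto simp: e U_def)
  have cases: "k \<le> ?c i \<or> k \<le> ?c j \<or> i \<in> U \<and> j \<in> U" if "(i, j) \<in> parcs G" for i j
    using c(2)[OF that] by (auto simp: U_def)
  have "k_cover G 1 e"
  proof (rule k_cover_posI[OF G ne])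
    show "1 \<le> Poly_Mapping.lookup e i + Poly_Mapping.lookup e j" if ij: "(i, j) \<in> parcs G" for i j
      using cases[OF ij] X[OF ij] G.in_arcsD1[OF ij] G.in_arcsD2[OF ij] by (auto simp: e)
  qed (use c(3) in \<open>auto simp: e in_keys_iff split: if_splits\<close>)
  moreover have "squarefree_cover e" by (simp add: squarefree_cover_def e)
  moreover have "cover_exponent G (c - e) (k - 1)"
  proof (rule cover_exponent_diff[OF G c(1) ne _ _ le])
    show "k - 1 + Poly_Mapping.lookup e i + Poly_Mapping.lookup e j \<le> ?c i + ?c j"
      if ij: "(i, j) \<in> parcs G" for i j
    proof (cases "i \<in> U \<and> j \<in> U")
      case True
      then have "Poly_Mapping.lookup e i + Poly_Mapping.lookup e j \<le> 1"
        using X[OF ij] by (auto simp: e U_def)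
      then show ?thesis using c(2)[OF ij] k by simp
    next
      case False
      then have "k \<le> ?c i \<or> k \<le> ?c j" using cases[OF ij] by blast
      \<comment> \<open>If both endpoints are chosen, both values are positive and one is at least \<open>k\<close>.\<close>
      then show ?thesis using le[of i] le[of j] k by (auto simp: e U_def)
    qed
    show "k - 1 + Poly_Mapping.lookup e i \<le> ?c i"
      if "i \<in> pverts G" "\<And>j. (i, j) \<notin> parcs G" for i
      using c(3)[OF that] k by (auto simp: e)
  qed
  ultimately show ?thesis using le by blast
qed

text \<open>
  Each step removes a squarefree cover of order 2 if the all-ones vector can be subtracted, and of
  order 1 otherwise. In the second case, if \<open>k \<ge> 2\<close>, there is a vertex that is isolated or has value
  0: its neighbour on an odd cycle cannot exist, or has value at least \<open>k\<close>.
\<close>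

lemma cover_exponent_imp_splits:
  assumes G: "pair_graph G"
    and dominating: "\<And>C i. pre_digraph.cycle (with_proj G) C \<Longrightarrow> odd (length C) \<Longrightarrow> i \<in> pverts G
      \<Longrightarrow> \<exists>j \<in> cycle_verts C. (i, j) \<in> parcs G"
    and "cover_exponent G c k"
  shows "splits G c k"
  using assms(3)
proof (induct k arbitrary: c rule: less_induct)
  case (less k)
  show ?case
  proof (cases "k = 0")
    case True
    then show ?thesis using less.prems by (simp add: cover_exponent_def splits.remainder)
  next
    case False
    with less.prems have cov: "k_cover G k c" by (simp add: cover_exponent_def)
    have "\<exists>e l. 1 \<le> l \<and> l \<le> k \<and> k_cover G l e \<and> squarefree_cover e \<and>
      (\<forall>i. Poly_Mapping.lookup e i \<le> Poly_Mapping.lookup c i) \<and> cover_exponent G (c - e) (k - l)"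
    proof (cases "2 \<le> k \<and> (\<forall>i \<in> pverts G. 1 \<le> Poly_Mapping.lookup c i \<and> (\<exists>j. (i, j) \<in> parcs G))")
      case True
      then show ?thesis
        using split_off_squarefree_2_cover[OF G cov] by (metis one_le_numeral)
    next
      case not2: False
      have "\<exists>j \<in> cycle_verts C. k \<le> Poly_Mapping.lookup c j \<or> Poly_Mapping.lookup c j = 0"
        if C: "pre_digraph.cycle (with_proj G) C" "odd (length C)" for C
      \<comment> \<open>For \<open>k = 1\<close> no value lies strictly between \<open>0\<close> and \<open>k\<close>.\<close>
      proof (cases "k = 1")
        case True
        have "cycle_verts C \<noteq> {}" using C(2) by (auto simp: cycle_verts_def)
        then show ?thesis using True by fastforce
      next
        case False
        then obtain i where i: "i \<in> pverts G"
            "Poly_Mapping.lookup c i = 0 \<or> (\<forall>j. (i, j) \<notin> parcs G)"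
          using not2 \<open>k \<noteq> 0\<close> by (force simp: not_le)
        obtain j where j: "j \<in> cycle_verts C" "(i, j) \<in> parcs G"
          using dominating[OF C i(1)] by blast
        moreover have "k \<le> Poly_Mapping.lookup c i + Poly_Mapping.lookup c j"
          using cov j(2) by (auto simp: k_cover_iff[OF G])
        ultimately show ?thesis using i(2) by auto
      qed
      from split_off_squarefree_1_cover[OF G cov _ this] False
      show ?thesis by (metis less_one linorder_not_less order_refl)
    qed
    then obtain e l where l: "1 \<le> l" "l \<le> k" and e: "k_cover G l e" "squarefree_cover e"
        and le: "\<And>i. Poly_Mapping.lookup e i \<le> Poly_Mapping.lookup c i"
        and rest: "cover_exponent G (c - e) (k - l)" by blast
    have "c = e + (c - e)"
      by (rule poly_mapping_eqI) (simp add: lookup_add lookup_minus le)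
    moreover have "splits G (c - e) (k - l)" using less.hyps[OF _ rest] l by simp
    ultimately show ?thesis using splits.add_cover[OF l(1) e, of "c - e" "k - l"] l(2) by simp
  qed
qed

text \<open>
  The value at \<open>i\<close> is 0, compensated by 2 at its neighbours; isolated vertices, possibly including \<open>i\<close>,
  need the value 2, and 1 suffices elsewhere. A squarefree 2-cover below \<open>c\<close> must have value 1 at a
  non-isolated \<open>i\<close> and value 2 at an isolated one. On the cycle \<open>c\<close> is at most 1, which is too little
  for two 1-covers.
\<close>

lemma obstructing_2_cover:
  assumes G: "pair_graph G" and C: "pre_digraph.cycle (with_proj G) C" "odd (length C)"
    and i: "i \<in> pverts G" and away: "\<And>j. j \<in> cycle_verts C \<Longrightarrow> (i, j) \<notin> parcs G"
  shows "\<exists>c. k_cover G 2 c \<and> \<not> splits G c 2"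
proof -
  interpret G: pair_graph G by fact
  from C(1) obtain u where u: "set C \<subseteq> parcs G" "pcas u C u"
    unfolding G.cycle_def G.awalk_def by blast
  have arcs: "fst a \<in> pverts G" "(fst a, snd a) \<in> parcs G" if "a \<in> set C" for a
    using u(1) that G.arc_fst_in_verts by auto
  define c where "c = vec (pverts G) (\<lambda>v.
    if (\<forall>w. (v, w) \<notin> parcs G) \<or> (i, v) \<in> parcs G then 2 else if v = i then 0 else 1)"
  have c: "Poly_Mapping.lookup c v = (if v \<notin> pverts G then 0
      else if (\<forall>w. (v, w) \<notin> parcs G) \<or> (i, v) \<in> parcs G then 2 else if v = i then 0 else 1)" for v
    by (simp add: c_def lookup_vec G.pair_finite_verts)
  have "k_cover G 2 c"
  proof (rule k_cover_posI[OF G])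
    show "2 \<le> Poly_Mapping.lookup c a + Poly_Mapping.lookup c b" if ab: "(a, b) \<in> parcs G" for a b
      using G.no_loops'[OF ab] G.in_arcsD1[OF ab] G.in_arcsD2[OF ab] ab G.arcs_symmetric[OF ab]
      by (auto simp: c)
  qed (use i in \<open>auto simp: c in_keys_iff split: if_splits\<close>)
  moreover have "\<not> splits G c 2"
  proof
    assume "splits G c 2"
    then obtain l m e d where split: "c = e + d" "2 = l + m" "1 \<le> l" "k_cover G l e"
        "squarefree_cover e" "splits G d m"
      by (auto elim: splits.cases)
    have cover_e: "(a, b) \<in> parcs G \<Longrightarrow> l \<le> Poly_Mapping.lookup e a + Poly_Mapping.lookup e b"
        "(\<forall>w. (i, w) \<notin> parcs G) \<Longrightarrow> l \<le> Poly_Mapping.lookup e i" for a b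
      using split(4) i by (auto simp: k_cover_iff[OF G])
    have e_le: "Poly_Mapping.lookup e v \<le> 1" for v
      using split(5) by (simp add: squarefree_cover_def)
    \<comment> \<open>For \<open>l = 1\<close> the rest \<open>d\<close> is a 1-cover because a splitting of order 1 always is one.\<close>
    from split(2,3) consider "l = 2" | "l = 1" "m = 1" by linarith
    then show False
    proof cases
      case 1
      then obtain j where j: "(i, j) \<in> parcs G"
        using cover_e(2) e_le[of i] by fastforce
      then have "Poly_Mapping.lookup c i = 0"
        using G.no_loops'[of i i] by (auto simp: c)
      then have "Poly_Mapping.lookup e i = 0" by (simp add: split(1) lookup_add)
      then show False using cover_e(1)[OF j] e_le[of j] 1 by simp
    next
      case 2
      then have "k_cover G 1 d"
        using splits_imp_cover_exponent[OF G split(6)] by (simp add: cover_exponent_def)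
      then have cover_d: "1 \<le> Poly_Mapping.lookup d (fst a) + Poly_Mapping.lookup d (snd a)"
        if "a \<in> set C" for a
        using arcs(2)[OF that] by (auto simp: k_cover_iff[OF G])
      have "length C < 2 * (\<Sum>a\<leftarrow>C. Poly_Mapping.lookup e (fst a))"
        using cover_e(1) arcs(2) 2(1) by (intro odd_closed_walk_cover_sum[OF u(2) C(2)]) fastforce
      moreover have "length C < 2 * (\<Sum>a\<leftarrow>C. Poly_Mapping.lookup d (fst a))"
        using cover_d by (rule odd_closed_walk_cover_sum[OF u(2) C(2)])
      moreover have "(\<Sum>a\<leftarrow>C. Poly_Mapping.lookup e (fst a)) + (\<Sum>a\<leftarrow>C. Poly_Mapping.lookup d (fst a))
          = (\<Sum>a\<leftarrow>C. Poly_Mapping.lookup c (fst a))"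
        by (simp add: split(1) lookup_add sum_list_addf)
      moreover have "(\<Sum>a\<leftarrow>C. Poly_Mapping.lookup c (fst a)) \<le> (\<Sum>a\<leftarrow>C. 1)"
      proof (rule sum_list_mono)
        fix a assume a: "a \<in> set C"
        then have "(i, fst a) \<notin> parcs G" using away by (auto simp: cycle_verts_def)
        moreover have "\<not> (\<forall>w. (fst a, w) \<notin> parcs G)" using arcs(2)[OF a] by blast
        ultimately show "Poly_Mapping.lookup c (fst a) \<le> 1" unfolding c by auto
      qed
      ultimately show False by (simp add: sum_list_triv)
    qed
  qed
  ultimately show ?thesis by blast
qed

theorem proposition2p7:
  fixes n :: nat and G :: "nat pair_pre_digraph"
  assumes "pair_graph G" and "pverts G = {1..n}"
  shows "(cover_algebra G :: 'a::field mpoly poly set) = squarefree_cover_algebra G \<longleftrightarrow>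
    (\<forall>C. pre_digraph.cycle (with_proj G) C \<and> odd (length C) \<longrightarrow>
       (\<forall>i \<in> pverts G. \<exists>j \<in> cycle_verts C. (i, j) \<in> parcs G))"
proof -
  have "(cover_algebra G :: 'a mpoly poly set) = squarefree_cover_algebra G
      \<longleftrightarrow> (\<forall>c k. cover_exponent G c k \<longleftrightarrow> splits G c k)"
    by (simp add: cover_algebra_eq squarefree_cover_algebra_eq exponent_polys_eq_iff)
  also have "\<dots> \<longleftrightarrow> (\<forall>c k. cover_exponent G c k \<longrightarrow> splits G c k)"
    using splits_imp_cover_exponent[OF assms(1)] by blast
  also have "\<dots> \<longleftrightarrow> (\<forall>C. pre_digraph.cycle (with_proj G) C \<and> odd (length C) \<longrightarrow>
       (\<forall>i \<in> pverts G. \<exists>j \<in> cycle_verts C. (i, j) \<in> parcs G))" (is "?split \<longleftrightarrow> ?dom")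
  proof
    assume ?dom
    then show ?split using cover_exponent_imp_splits[OF assms(1)] by blast
  next
    assume split: ?split
    have "splits G c 2" if "k_cover G 2 c" for c
      using split that by (simp add: cover_exponent_def)
    then show ?dom using obstructing_2_cover[OF assms(1)] by blast
  qed
  finally show ?thesis .
qed

end
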